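(* Let $G$ be a finite solvable group with trivial center, let $F(G)$ be its Fitting subgroup, and let $x$ be a small element of $G$. Then the following are equivalent: (1) $x \in Z(F(G))$; (2) $[x, F(G)]$ is a normal subset of $F(G)$.
   Context: For a finite group $G$, an element $x \in G$ is called small if $x$ is non-central and its conjugacy class has the smallest size among all conjugacy classes of non-central elements of $G$. $F(G)$ denotes the Fitting subgroup and $Z(H)$ the center of $H$. Commutators are $[x,h] = x^{-1}h^{-1}xh$. For $x \in G$ and a subgroup $H \le G$, $[x,H]$ denotes the set $\{[x,h] : h \in H\}$ (a set, not the subgroup it generates). A subset $S$ of a group $H$ is normal (in $H$) if $h^{-1}Sh = S$ for all $h \in H$. *)

theory Defs
  imports "HOL-Algebra.Algebra"
begin

definition center :: "('a, 'b) monoid_scheme \<Rightarrow> 'a set" where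
  "center G = {z \<in> carrier G. \<forall>g \<in> carrier G. z \<otimes>\<^bsub>G\<^esub> g = g \<otimes>\<^bsub>G\<^esub> z}"

definition conj_class :: "('a, 'b) monoid_scheme \<Rightarrow> 'a \<Rightarrow> 'a set" where
  "conj_class G x = (\<lambda>g. inv\<^bsub>G\<^esub> g \<otimes>\<^bsub>G\<^esub> x \<otimes>\<^bsub>G\<^esub> g) ` carrier G"

text \<open>Class sizes are measured by \<^const>\<open>card\<close>, so this notion is meant for finite groups.\<close>

definition small_element :: "('a, 'b) monoid_scheme \<Rightarrow> 'a \<Rightarrow> bool" where
  "small_element G x \<longleftrightarrow>
     x \<in> carrier G - center G \<and>
     (\<forall>y \<in> carrier G - center G. card (conj_class G x) \<le> card (conj_class G y))"

definition commutator :: "('a, 'b) monoid_scheme \<Rightarrow> 'a \<Rightarrow> 'a \<Rightarrow> 'a" where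
  "commutator G x h = inv\<^bsub>G\<^esub> x \<otimes>\<^bsub>G\<^esub> inv\<^bsub>G\<^esub> h \<otimes>\<^bsub>G\<^esub> x \<otimes>\<^bsub>G\<^esub> h"

text \<open>The bare set of commutators, not the subgroup it generates.\<close>

definition commutator_set :: "('a, 'b) monoid_scheme \<Rightarrow> 'a \<Rightarrow> 'a set \<Rightarrow> 'a set" where
  "commutator_set G x H = commutator G x ` H"

definition normal_subset :: "('a, 'b) monoid_scheme \<Rightarrow> 'a set \<Rightarrow> bool" where
  "normal_subset H S \<longleftrightarrow>
     S \<subseteq> carrier H \<and>
     (\<forall>h \<in> carrier H. (\<lambda>s. inv\<^bsub>H\<^esub> h \<otimes>\<^bsub>H\<^esub> s \<otimes>\<^bsub>H\<^esub> h) ` S = S)"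

primrec lower_central :: "('a, 'b) monoid_scheme \<Rightarrow> nat \<Rightarrow> 'a set" where
  "lower_central G 0 = carrier G"
| "lower_central G (Suc n) =
     generate G (\<Union>x \<in> lower_central G n. commutator_set G x (carrier G))"

definition nilpotent :: "('a, 'b) monoid_scheme \<Rightarrow> bool" where
  "nilpotent G \<longleftrightarrow> (\<exists>n. lower_central G n = {\<one>\<^bsub>G\<^esub>})"

text \<open>The subgroup generated by all nilpotent normal subgroups. For finite \<open>G\<close> it is
  itself nilpotent (Fitting's theorem), hence the largest nilpotent normal subgroup.\<close>

definition fitting :: "('a, 'b) monoid_scheme \<Rightarrow> 'a set" where
  "fitting G = generate G (\<Union>{N. N \<lhd> G \<and> nilpotent (G\<lparr>carrier := N\<rparr>)})"

end

theory Submission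
  imports Defs
begin

text \<open>
  Write \<open>F\<close> for the Fitting subgroup. If \<open>x\<close> lies in \<open>Z(F)\<close>, then \<open>[x, F] = {1}\<close> is normal. The
  converse rests on two facts.

  First, \<open>x\<close> centralizes every normal subgroup \<open>H\<close> of \<open>G\<close> for which \<open>S = [x, H]\<close> is a normal
  subset of \<open>H\<close>. Let \<open>K = C\<^sub>G(x)\<close>. Besides \<open>H\<close>, also
  \<open>K\<close> leaves \<open>S\<close> invariant under conjugation, because \<open>[x, h]\<^sup>k = [x, h\<^sup>k]\<close> for \<open>k\<close> in \<open>K\<close>. Hence
  the subgroup \<open>H K\<close> acts by conjugation on \<open>S - {1}\<close>, while the orbit of \<open>x\<close> under \<open>H K\<close> is the
  translate \<open>x S\<close>. Suppose that \<open>z \<noteq> 1\<close> is an element of \<open>S\<close>. Counting \<open>H K\<close> once through the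
  orbit of \<open>x\<close> and once through the orbit of \<open>z\<close> gives
  \<open>|S| |K| = |H K| \<le> (|S| - 1) |C\<^sub>G(z)|\<close>, so \<open>|C\<^sub>G(z)| > |K|\<close> and the class of \<open>z\<close> is strictly
  smaller than that of \<open>x\<close> (\<open>conj_class_of_commutator_smaller\<close>). As the center of \<open>G\<close> is trivial,
  \<open>z\<close> is not central, which contradicts that \<open>x\<close> is small.

  Second, in a solvable group \<open>C\<^sub>G(F) \<le> F\<close> (\<open>centralizer_fitting_subset\<close>). If a term \<open>N\<close> of the
  derived series of \<open>C\<^sub>G(F)\<close> has its derived subgroup inside \<open>F\<close>, then this derived subgroup is
  central in \<open>N\<close>. So \<open>N\<close> is a nilpotent normal subgroup of \<open>G\<close> and lies in \<open>F\<close> itself. Starting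
  at the trivial term and going back along the series, one reaches \<open>C\<^sub>G(F) \<le> F\<close>.
\<close>

section \<open>Centralizers and orbits under conjugation\<close>

definition centralizer :: "('a, 'b) monoid_scheme \<Rightarrow> 'a set \<Rightarrow> 'a set" where
  "centralizer G S = {g \<in> carrier G. \<forall>s \<in> S. g \<otimes>\<^bsub>G\<^esub> s = s \<otimes>\<^bsub>G\<^esub> g}"

context group
begin

abbreviation conjugate :: "'a \<Rightarrow> 'a \<Rightarrow> 'a" where
  "conjugate x g \<equiv> inv g \<otimes> x \<otimes> g"

lemma inv_mult_cancel:
  assumes "a \<in> carrier G" "b \<in> carrier G"
  shows "inv a \<otimes> (a \<otimes> b) = b" "a \<otimes> (inv a \<otimes> b) = b"
  using assms by (simp_all add: m_assoc[symmetric])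

lemma conjugate_conjugate:
  "\<lbrakk>x \<in> carrier G; g \<in> carrier G; h \<in> carrier G\<rbrakk>
    \<Longrightarrow> conjugate (conjugate x g) h = conjugate x (g \<otimes> h)"
  by (simp add: m_assoc inv_mult_group)

lemma conjugate_eq_iff_commute:
  assumes "x \<in> carrier G" "g \<in> carrier G" "y \<in> carrier G"
  shows "conjugate x g = y \<longleftrightarrow> x \<otimes> g = g \<otimes> y"
proof -
  have "conjugate x g = y \<longleftrightarrow> g \<otimes> conjugate x g = g \<otimes> y"
    using assms by (simp only: Units_l_cancel Units_eq m_closed inv_closed)
  moreover have "g \<otimes> conjugate x g = x \<otimes> g"
    using assms by (simp add: m_assoc inv_mult_cancel)
  ultimately show ?thesis by simp
qed

lemma conjugate_eq_one_iff:
  assumes "x \<in> carrier G" "g \<in> carrier G"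
  shows "conjugate x g = \<one> \<longleftrightarrow> x = \<one>"
  using assms conjugate_eq_iff_commute[of x g \<one>] by simp

lemma subgroup_centralizer:
  assumes "S \<subseteq> carrier G" shows "subgroup (centralizer G S) G"
proof (rule subgroupI)
  show "centralizer G S \<subseteq> carrier G" "centralizer G S \<noteq> {}"
    using assms by (auto simp: centralizer_def intro!: exI[of _ \<one>])
next
  fix a assume a: "a \<in> centralizer G S"
  have "inv a \<otimes> s = s \<otimes> inv a" if "s \<in> S" for s
  proof -
    have s: "s \<in> carrier G" "a \<in> carrier G" "a \<otimes> s = s \<otimes> a"
      using that a assms by (auto simp: centralizer_def)
    have "inv a \<otimes> s = inv a \<otimes> (s \<otimes> a) \<otimes> inv a" using s(1,2) by (simp add: m_assoc)
    also have "\<dots> = s \<otimes> inv a" using s(1,2) by (simp add: s(3)[symmetric] inv_mult_cancel)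
    finally show ?thesis .
  qed
  then show "inv a \<in> centralizer G S" using a by (simp add: centralizer_def)
next
  fix a b assume ab: "a \<in> centralizer G S" "b \<in> centralizer G S"
  have "a \<otimes> b \<otimes> s = s \<otimes> (a \<otimes> b)" if "s \<in> S" for s
  proof -
    have s: "s \<in> carrier G" "a \<in> carrier G" "b \<in> carrier G" "a \<otimes> s = s \<otimes> a" "b \<otimes> s = s \<otimes> b"
      using that ab assms by (auto simp: centralizer_def)
    have "a \<otimes> b \<otimes> s = a \<otimes> s \<otimes> b" using s(1-3,5) by (simp add: m_assoc)
    then show ?thesis using s(1-3) by (simp add: s(4) m_assoc)
  qed
  then show "a \<otimes> b \<in> centralizer G S" using ab by (simp add: centralizer_def)
qed

lemma normal_centralizer:
  assumes "H \<lhd> G" shows "centralizer G H \<lhd> G"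
proof (rule normal_invI)
  interpret H: normal H G by fact
  show "subgroup (centralizer G H) G" by (rule subgroup_centralizer[OF H.subset])
  fix g c assume g: "g \<in> carrier G" and c: "c \<in> centralizer G H"
  have cG: "c \<in> carrier G" using c by (simp add: centralizer_def)
  have "g \<otimes> c \<otimes> inv g \<otimes> h = h \<otimes> (g \<otimes> c \<otimes> inv g)" if h: "h \<in> H" for h
  proof -
    have hG: "h \<in> carrier G" using h H.subset by auto
    have "inv g \<otimes> h \<otimes> g \<in> H" by (rule H.inv_op_closed1[OF g h])
    then have comm: "c \<otimes> (inv g \<otimes> h \<otimes> g) = (inv g \<otimes> h \<otimes> g) \<otimes> c"
      using c by (simp add: centralizer_def)
    have "g \<otimes> c \<otimes> inv g \<otimes> h = g \<otimes> (c \<otimes> (inv g \<otimes> h \<otimes> g)) \<otimes> inv g"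
      using g hG cG by (simp add: m_assoc inv_mult_cancel)
    also have "\<dots> = h \<otimes> (g \<otimes> c \<otimes> inv g)"
      unfolding comm using g hG cG by (simp add: m_assoc inv_mult_cancel)
    finally show ?thesis .
  qed
  then show "g \<otimes> c \<otimes> inv g \<in> centralizer G H"
    using g cG by (simp add: centralizer_def)
qed

text \<open>This is the orbit-stabilizer theorem for the conjugation action of a subgroup \<open>M\<close> on \<open>G\<close>: the
  elements of \<open>M\<close> that carry \<open>x\<close> to a fixed conjugate form a right coset of the stabilizer of
  \<open>x\<close> in \<open>M\<close>.\<close>

lemma card_conjugates_mult_card_centralizer:
  assumes M: "subgroup M G" and fin: "finite M" and x: "x \<in> carrier G"
  shows "card (conjugate x ` M) * card (M \<inter> centralizer G {x}) = card M"
proof -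
  interpret M: subgroup M G by (rule M)
  let ?C = "M \<inter> centralizer G {x}"
  have fiber: "card {g \<in> M. conjugate x g = y} = card ?C" if y: "y \<in> conjugate x ` M" for y
  proof -
    obtain m where m: "m \<in> M" "y = conjugate x m" using y by auto
    have mG: "m \<in> carrier G" using m M.subset by auto
    have "bij_betw (\<lambda>c. c \<otimes> m) ?C {g \<in> M. conjugate x g = y}"
    proof (rule bij_betwI[where g = "\<lambda>g. g \<otimes> inv m"])
      show "(\<lambda>c. c \<otimes> m) \<in> ?C \<rightarrow> {g \<in> M. conjugate x g = y}"
      proof
        fix c assume c: "c \<in> ?C"
        have cG: "c \<in> carrier G" "conjugate x c = x"
          using c x by (auto simp: centralizer_def conjugate_eq_iff_commute)
        then show "c \<otimes> m \<in> {g \<in> M. conjugate x g = y}"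
          using c m x mG conjugate_conjugate[of x c m] by simp
      qed
      show "(\<lambda>g. g \<otimes> inv m) \<in> {g \<in> M. conjugate x g = y} \<rightarrow> ?C"
      proof
        fix g assume g: "g \<in> {g \<in> M. conjugate x g = y}"
        have gG: "g \<in> carrier G" using g M.subset by auto
        have "conjugate x (g \<otimes> inv m) = conjugate (conjugate x m) (inv m)"
          using conjugate_conjugate[of x g "inv m"] g m x mG gG by simp
        also have "\<dots> = x" using x mG by (simp only: conjugate_conjugate inv_closed r_inv) simp
        finally show "g \<otimes> inv m \<in> ?C"
          using g m x mG gG by (simp add: centralizer_def conjugate_eq_iff_commute)
      qed
    qed (use mG M.subset in \<open>auto simp: m_assoc\<close>)
    then show ?thesis by (simp add: bij_betw_same_card)
  qed
  have "card M = (\<Sum>y \<in> conjugate x ` M. card {g \<in> M. conjugate x g = y})"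
    unfolding card_eq_sum by (rule sum.image_gen[OF fin])
  also have "\<dots> = card (conjugate x ` M) * card ?C" using fiber by simp
  finally show ?thesis by simp
qed

lemma card_conj_class_mult_card_centralizer:
  assumes "finite (carrier G)" "x \<in> carrier G"
  shows "card (conj_class G x) * card (centralizer G {x}) = card (carrier G)"
proof -
  have "carrier G \<inter> centralizer G {x} = centralizer G {x}" by (auto simp: centralizer_def)
  then show ?thesis
    using card_conjugates_mult_card_centralizer[OF subgroup_self assms] by (simp add: conj_class_def)
qed


section \<open>Normal sets of commutators and class sizes\<close>

lemma commutator_closed:
  "\<lbrakk>x \<in> carrier G; h \<in> carrier G\<rbrakk> \<Longrightarrow> commutator G x h \<in> carrier G"
  by (simp add: commutator_def)

lemma mult_commutator:
  "\<lbrakk>x \<in> carrier G; h \<in> carrier G\<rbrakk> \<Longrightarrow> x \<otimes> commutator G x h = conjugate x h"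
  by (simp add: commutator_def m_assoc inv_mult_cancel)

lemma commutator_eq_one_iff:
  assumes "x \<in> carrier G" "h \<in> carrier G"
  shows "commutator G x h = \<one> \<longleftrightarrow> x \<otimes> h = h \<otimes> x"
proof -
  have "commutator G x h = \<one> \<longleftrightarrow> x \<otimes> commutator G x h = x"
    using assms by (simp only: l_cancel_one commutator_closed)
  also have "\<dots> \<longleftrightarrow> conjugate x h = x" using assms by (simp only: mult_commutator)
  finally show ?thesis using assms by (simp only: conjugate_eq_iff_commute)
qed

lemma commutator_conjugate:
  assumes "x \<in> carrier G" "h \<in> carrier G" "k \<in> centralizer G {x}"
  shows "conjugate (commutator G x h) k = commutator G x (conjugate h k)"
proof -
  have k: "k \<in> carrier G" "x \<otimes> k = k \<otimes> x" using assms(3) by (auto simp: centralizer_def)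
  have ki: "inv k \<otimes> inv x = inv x \<otimes> inv k"
    using k assms(1) by (metis inv_mult_group)
  have "commutator G x (conjugate h k)
      = inv x \<otimes> inv k \<otimes> inv h \<otimes> (k \<otimes> x) \<otimes> (inv k \<otimes> h \<otimes> k)"
    using assms k(1) by (simp add: commutator_def m_assoc inv_mult_group)
  also have "\<dots> = inv k \<otimes> inv x \<otimes> inv h \<otimes> (x \<otimes> k) \<otimes> (inv k \<otimes> h \<otimes> k)"
    by (simp only: ki k(2))
  also have "\<dots> = conjugate (commutator G x h) k"
    using assms k(1) by (simp add: commutator_def m_assoc inv_mult_cancel)
  finally show ?thesis by simp
qed

lemma normal_subset_imp_conjugate_closed:
  assumes "subgroup H G" "normal_subset (G\<lparr>carrier := H\<rparr>) S" "s \<in> S" "h \<in> H"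
  shows "conjugate s h \<in> S"
  using assms by (auto simp: normal_subset_def)

text \<open>The subgroup \<open>M = H C\<^sub>G(x)\<close> acts on both \<open>x S\<close> and \<open>S - {\<one>}\<close>, where \<open>S = [x, H]\<close>. The first
  action is transitive, with stabilizer \<open>C\<^sub>G(x)\<close> at the point \<open>x\<close>, and the second set has one element less, so the
  stabilizer of \<open>z\<close> must be larger than \<open>C\<^sub>G(x)\<close>.\<close>

lemma conj_class_of_commutator_smaller:
  assumes fin: "finite (carrier G)" and H: "H \<lhd> G" and x: "x \<in> carrier G"
    and nrm: "normal_subset (G\<lparr>carrier := H\<rparr>) (commutator_set G x H)"
    and z: "z \<in> commutator_set G x H" "z \<noteq> \<one>"
  shows "card (conj_class G z) < card (conj_class G x)"
proof -
  interpret H: normal H G by (rule H)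
  define K where "K = centralizer G {x}"
  define S where "S = commutator_set G x H"
  define M where "M = H <#> K"
  have HG: "h \<in> carrier G" if "h \<in> H" for h using that H.subset by auto
  have K: "subgroup K G" unfolding K_def using x by (intro subgroup_centralizer) simp
  interpret K: subgroup K G by (rule K)
  have M: "subgroup M G" unfolding M_def by (rule mult_norm_subgroup[OF H K])
  interpret M: subgroup M G by (rule M)
  have SG: "s \<in> carrier G" if "s \<in> S" for s
    using that x HG by (auto simp: S_def commutator_set_def commutator_closed)
  have finite: "finite M" "finite S" "finite (centralizer G {z})"
    using fin M.subset SG by (auto intro: finite_subset simp: centralizer_def)
  have S_H: "conjugate s h \<in> S" if "s \<in> S" "h \<in> H" for s h
    using normal_subset_imp_conjugate_closed[OF H.subgroup_axioms nrm] that by (simp add: S_def)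
  have S_K: "conjugate s k \<in> S" if s: "s \<in> S" and k: "k \<in> K" for s k
  proof -
    obtain h where h: "h \<in> H" "s = commutator G x h"
      using s by (auto simp: S_def commutator_set_def)
    have "conjugate h k \<in> H" using h k by (simp add: H.inv_op_closed1)
    then show ?thesis
      using h k x HG commutator_conjugate[of x h k] by (auto simp: S_def commutator_set_def K_def)
  qed
  have S_M: "conjugate s m \<in> S" if s: "s \<in> S" and m: "m \<in> M" for s m
  proof -
    obtain h k where hk: "h \<in> H" "k \<in> K" "m = h \<otimes> k"
      using m by (auto simp: M_def set_mult_def)
    have "conjugate (conjugate s h) k \<in> S" using S_H S_K s hk by blast
    then show ?thesis using hk HG SG s by (simp add: conjugate_conjugate)
  qed

  have H_M: "H \<subseteq> M"
  proof
    fix h assume "h \<in> H"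
    then have "h \<otimes> \<one> \<in> M" unfolding M_def set_mult_def using K.one_closed by blast
    then show "h \<in> M" using HG[OF \<open>h \<in> H\<close>] by simp
  qed
  have K_M: "K \<subseteq> M"
  proof
    fix k assume "k \<in> K"
    then have "\<one> \<otimes> k \<in> M" unfolding M_def set_mult_def using H.one_closed by blast
    then show "k \<in> M" using \<open>k \<in> K\<close> by simp
  qed

  \<comment> \<open>For \<open>h\<close> in \<open>H\<close> and \<open>k\<close> in \<open>K\<close>: \<open>x\<^sup>h\<^sup>k = (x [x, h])\<^sup>k = x [x, h]\<^sup>k\<close>, as \<open>k\<close> fixes \<open>x\<close>.\<close>
  have orbit_x: "conjugate x ` M = (\<lambda>s. x \<otimes> s) ` S"
  proof (intro equalityI subsetI)
    fix y assume "y \<in> conjugate x ` M"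
    then obtain h k where hk: "h \<in> H" "k \<in> K" "y = conjugate x (h \<otimes> k)"
      by (auto simp: M_def set_mult_def)
    let ?s = "commutator G x h"
    have s: "?s \<in> S" using hk by (auto simp: S_def commutator_set_def)
    have k: "k \<in> carrier G" "x \<otimes> k = k \<otimes> x"
      using hk(2) unfolding K_def centralizer_def by simp_all
    have "y = conjugate (x \<otimes> ?s) k"
      using hk(1,3) k(1) x HG[OF hk(1)] by (simp only: conjugate_conjugate mult_commutator)
    also have "\<dots> = conjugate x k \<otimes> conjugate ?s k"
      using k(1) x SG[OF s] by (simp add: m_assoc inv_mult_cancel)
    also have "conjugate x k = x" using k x by (simp only: conjugate_eq_iff_commute)
    finally show "y \<in> (\<lambda>s. x \<otimes> s) ` S" using S_K[OF s hk(2)] by simp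
  next
    fix y assume "y \<in> (\<lambda>s. x \<otimes> s) ` S"
    then obtain h where "h \<in> H" "y = x \<otimes> commutator G x h"
      by (auto simp: S_def commutator_set_def)
    then show "y \<in> conjugate x ` M" using H_M HG x by (auto simp: mult_commutator)
  qed
  have "inj_on (\<lambda>s. x \<otimes> s) S" using x SG by (auto intro: inj_onI)
  then have "card (conjugate x ` M) = card S" by (simp add: orbit_x card_image)
  moreover have "M \<inter> centralizer G {x} = K" using K_M by (auto simp: K_def)
  ultimately have card_M: "card S * card K = card M"
    using card_conjugates_mult_card_centralizer[OF M finite(1) x] by simp

  have zS: "z \<in> S" and zG: "z \<in> carrier G" using z SG by (auto simp: S_def)
  have one_S: "\<one> \<in> S"
    unfolding S_def commutator_set_def
    using x H.one_closed by (intro image_eqI[of _ _ "\<one>"]) (simp_all add: commutator_def)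
  have "conjugate z ` M \<subseteq> S - {\<one>}"
    using S_M zS z(2) zG by (auto simp: conjugate_eq_one_iff)
  then have "card (conjugate z ` M) \<le> card S - 1"
    using one_S finite(2) by (metis card_Diff_singleton card_mono finite_Diff)
  moreover have "card (M \<inter> centralizer G {z}) \<le> card (centralizer G {z})"
    using finite(3) by (intro card_mono) auto
  ultimately have "card M \<le> (card S - 1) * card (centralizer G {z})"
    unfolding card_conjugates_mult_card_centralizer[OF M finite(1) zG, symmetric]
    by (rule mult_le_mono)
  then have le: "card S * card K \<le> (card S - 1) * card (centralizer G {z})"
    by (simp add: card_M)
  have pos: "card K > 0" "card S > 0"
    using K.finite_imp_card_positive[OF fin] finite(2) one_S by (auto simp: card_gt_0_iff)
  have cent: "card K < card (centralizer G {z})"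
  proof (rule ccontr)
    assume "\<not> ?thesis"
    then have "(card S - 1) * card (centralizer G {z}) \<le> (card S - 1) * card K" by simp
    also have "\<dots> < card S * card K" using pos by simp
    finally show False using le by simp
  qed

  have eq: "card (conj_class G z) * card (centralizer G {z}) = card (conj_class G x) * card K"
    using card_conj_class_mult_card_centralizer[OF fin] x zG by (simp add: K_def)
  have pos_x: "card (conj_class G x) > 0"
    unfolding conj_class_def card_gt_0_iff using fin one_closed by blast
  show ?thesis
  proof (rule ccontr)
    assume not: "\<not> ?thesis"
    then have "card (conj_class G x) * card K \<le> card (conj_class G z) * card K" by simp
    also have "\<dots> < card (conj_class G z) * card (centralizer G {z})"
      using cent pos_x not by simp
    finally show False using eq by simp
  qed
qed

text \<open>A nontrivial element of \<open>[x, H]\<close> would be a noncentral element whose class is smaller than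
  that of \<open>x\<close>.\<close>

lemma small_element_in_centralizer:
  assumes "finite (carrier G)" "center G = {\<one>}" "small_element G x" and H: "H \<lhd> G"
    and "normal_subset (G\<lparr>carrier := H\<rparr>) (commutator_set G x H)"
  shows "x \<in> centralizer G H"
proof -
  interpret H: normal H G by (rule H)
  have x: "x \<in> carrier G" using assms by (simp add: small_element_def)
  have "x \<otimes> h = h \<otimes> x" if h: "h \<in> H" for h
  proof (rule ccontr)
    assume "x \<otimes> h \<noteq> h \<otimes> x"
    let ?z = "commutator G x h"
    have hG: "h \<in> carrier G" using h H.subset by auto
    have z: "?z \<noteq> \<one>" using \<open>x \<otimes> h \<noteq> h \<otimes> x\<close> x hG by (simp add: commutator_eq_one_iff)
    have "card (conj_class G ?z) < card (conj_class G x)"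
      using assms x h z by (intro conj_class_of_commutator_smaller) (auto simp: commutator_set_def)
    moreover have "?z \<in> carrier G - center G"
      using z x hG assms(2) by (simp add: commutator_closed)
    ultimately show False using assms(3) by (force simp: small_element_def not_less[symmetric])
  qed
  then show ?thesis using x by (simp add: centralizer_def)
qed


section \<open>The centralizer of the Fitting subgroup of a solvable group\<close>

text \<open>Groups of nilpotency class at most two: the first term of the lower central series consists of
  central elements, whose commutators vanish.\<close>

lemma derived_central_imp_nilpotent:
  assumes "derived G (carrier G) \<subseteq> center G"
  shows "nilpotent G"
proof -
  have "commutator G x h \<in> derived G (carrier G)"
    if xh: "x \<in> carrier G" "h \<in> carrier G" for x h
  proof -
    \<comment> \<open>The derived subgroup is generated by the elements \<open>a b a\<inverse> b\<inverse>\<close>.\<close>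
    have "commutator G x h = inv x \<otimes> inv h \<otimes> inv (inv x) \<otimes> inv (inv h)"
      using xh by (simp add: commutator_def)
    also have "\<dots> \<in> derived_set G (carrier G)"
      using xh by (intro UN_I[of "inv x"] UN_I[of "inv h"]) simp_all
    finally show ?thesis unfolding derived_def by (rule generate.incl)
  qed
  then have "lower_central G (Suc 0) \<subseteq> derived G (carrier G)"
    unfolding lower_central.simps commutator_set_def
    by (intro generate_subgroup_incl derived_is_subgroup) auto
  then have central: "lower_central G (Suc 0) \<subseteq> center G" using assms by blast
  have "commutator_set G x (carrier G) \<subseteq> {\<one>}" if "x \<in> lower_central G (Suc 0)" for x
  proof -
    have "x \<in> center G" using that central by blast
    then show ?thesis by (auto simp: commutator_set_def center_def commutator_eq_one_iff)
  qed
  then have "(\<Union>x \<in> lower_central G (Suc 0). commutator_set G x (carrier G)) \<subseteq> {\<one>}" by blast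
  then have "lower_central G (Suc (Suc 0)) \<subseteq> {\<one>}"
    unfolding lower_central.simps(2)[of G "Suc 0"]
    by (rule generate_subgroup_incl[OF _ triv_subgroup])
  moreover have "\<one> \<in> lower_central G (Suc (Suc 0))"
    unfolding lower_central.simps(2)[of G "Suc 0"] by (rule generate.one)
  ultimately have "lower_central G (Suc (Suc 0)) = {\<one>}" by blast
  then show ?thesis unfolding nilpotent_def by blast
qed

lemma normal_fitting: "fitting G \<lhd> G"
  unfolding fitting_def
proof (rule normal_generateI)
  show "\<Union>{N. N \<lhd> G \<and> nilpotent (G\<lparr>carrier := N\<rparr>)} \<subseteq> carrier G"
    using normal_imp_subgroup subgroup.subset by blast
next
  fix h g
  assume "h \<in> \<Union>{N. N \<lhd> G \<and> nilpotent (G\<lparr>carrier := N\<rparr>)}" "g \<in> carrier G"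
  then show "g \<otimes> h \<otimes> inv g \<in> \<Union>{N. N \<lhd> G \<and> nilpotent (G\<lparr>carrier := N\<rparr>)}"
    using normal.inv_op_closed2 by fastforce
qed

lemma nilpotent_normal_subset_fitting:
  assumes "N \<lhd> G" "nilpotent (G\<lparr>carrier := N\<rparr>)" shows "N \<subseteq> fitting G"
  using assms unfolding fitting_def by (auto intro: generate.incl)

text \<open>The elements of \<open>N\<close> commute with those of \<open>F\<close>, so a derived subgroup of \<open>N\<close> inside \<open>F\<close> is
  central in \<open>N\<close>. This is the step that climbs the derived series of \<open>C\<^sub>G(F)\<close>.\<close>

lemma normal_subset_fitting_if_derived_subset:
  assumes N: "N \<lhd> G" "N \<subseteq> centralizer G (fitting G)" and der: "derived G N \<subseteq> fitting G"
  shows "N \<subseteq> fitting G"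
proof (rule nilpotent_normal_subset_fitting[OF N(1)])
  interpret N: normal N G by (rule N(1))
  interpret GN: group "G\<lparr>carrier := N\<rparr>" by (rule N.subgroup_is_group) (rule group_axioms)
  have "derived G N \<subseteq> N" by (rule derived_incl[OF subset_refl N.subgroup_axioms])
  then have "derived G N \<subseteq> center (G\<lparr>carrier := N\<rparr>)"
    using N(2) der by (fastforce simp: center_def centralizer_def)
  then show "nilpotent (G\<lparr>carrier := N\<rparr>)"
    using derived_consistent[OF subset_refl N.subgroup_axioms]
    by (intro GN.derived_central_imp_nilpotent) simp
qed

lemma centralizer_fitting_subset:
  assumes "solvable G" shows "centralizer G (fitting G) \<subseteq> fitting G"
proof -
  define C where "C = centralizer G (fitting G)"
  define D where "D n = (derived G ^^ n) C" for n
  have C: "C \<lhd> G" unfolding C_def by (rule normal_centralizer[OF normal_fitting])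
  have D_Suc: "D (Suc n) = derived G (D n)" for n by (simp add: D_def)
  have D: "D n \<lhd> G \<and> D n \<subseteq> C" for n
  proof (induction n)
    case 0 show ?case using C by (simp add: D_def)
  next
    case (Suc n)
    then show ?case unfolding D_Suc
      using derived_is_normal derived_incl[OF _ normal_imp_subgroup[OF C]] by blast
  qed
  obtain n where "D n = {\<one>}"
    unfolding D_def
    using solvable_imp_trivial_derived_seq solvable_subgroup[OF normal_imp_subgroup[OF C] assms]
    by blast
  then have "D n \<subseteq> fitting G"
    using subgroup.one_closed[OF normal_imp_subgroup[OF normal_fitting]] by simp
  then have "D 0 \<subseteq> fitting G"
  proof (induction n)
    case (Suc n)
    have "D n \<subseteq> fitting G"
      using D[of n] Suc.prems
      by (intro normal_subset_fitting_if_derived_subset[of "D n"]) (simp_all add: C_def D_Suc)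
    then show ?case by (rule Suc.IH)
  qed
  then show ?thesis by (simp add: D_def C_def)
qed

end


section \<open>Small elements and the center of the Fitting subgroup\<close>

theorem proposition2p5:
  fixes G :: "('a, 'b) monoid_scheme" and x :: 'a
  assumes "group G"
    and "finite (carrier G)"
    and "solvable G"
    and "center G = {\<one>\<^bsub>G\<^esub>}"
    and "small_element G x"
  shows "x \<in> center (G\<lparr>carrier := fitting G\<rparr>) \<longleftrightarrow>
    normal_subset (G\<lparr>carrier := fitting G\<rparr>) (commutator_set G x (fitting G))"
proof -
  interpret group G by (rule assms(1))
  interpret F: normal "fitting G" G by (rule normal_fitting)
  show ?thesis
  proof
    assume x: "x \<in> center (G\<lparr>carrier := fitting G\<rparr>)"
    have "commutator G x h = \<one>\<^bsub>G\<^esub>" if "h \<in> fitting G" for h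
      using x that by (simp add: commutator_eq_one_iff center_def)
    then have "commutator_set G x (fitting G) = {\<one>\<^bsub>G\<^esub>}"
      unfolding commutator_set_def using F.one_closed by (auto intro!: image_eqI[of _ _ "\<one>\<^bsub>G\<^esub>"])
    then show "normal_subset (G\<lparr>carrier := fitting G\<rparr>) (commutator_set G x (fitting G))"
      using F.subgroup_axioms by (simp add: normal_subset_def)
  next
    assume "normal_subset (G\<lparr>carrier := fitting G\<rparr>) (commutator_set G x (fitting G))"
    then have x: "x \<in> centralizer G (fitting G)"
      using assms normal_fitting by (intro small_element_in_centralizer)
    then have "x \<in> fitting G" using centralizer_fitting_subset[OF assms(3)] by blast
    then show "x \<in> center (G\<lparr>carrier := fitting G\<rparr>)"
      using x by (simp add: center_def centralizer_def)
  qed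
qed

end
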